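(* Let $\mathcal{X}=[0,1]^d$ with Lebesgue measure $\lambda$, and let $p_0\equiv1$ denote the uniform density on $\mathcal{X}$. Suppose $\{p_0\}\cup\{\phi_z\}_{z\in\mathcal{Z}}$ is an orthonormal basis of $L^2_\lambda(\mathcal{X})$, with $\mathcal{Z}$ countable and each $\phi_z:\mathcal{X}\to\mathbb{R}$ bounded, and let $\{a_z\}_{z\in\mathcal{Z}}$ and $\{b_z\}_{z\in\mathcal{Z}}$ be two non-negative real-valued nets. Let $L_D,L_G\ge0$ and $p,q\ge2$, and let $n\ge 1$. For finite nonempty $Z\subseteq\mathcal{Z}$ with $\sup_{z\in Z}a_z>0$ and $\sup_{z\in Z}b_z>0$, let $$A_Z:=|Z|^{1/2}\sup_{z\in Z}a_z\quad\text{and}\quad B_Z:=|Z|^{1/2}\sup_{z\in Z}b_z .$$ Then, for $\mathcal{F}_D=\mathcal{H}_{p,a}(L_D)$ and $\mathcal{F}_G=\mathcal{H}_{q,b}(L_G)$, and for any such $Z$ satisfying $$B_Z\ge16L_G\sqrt{\frac{n}{\log2}}\quad\text{and}\quad 2\frac{L_G}{B_Z}\sum_{z\in Z}\|\phi_z\|_{L^\infty_\lambda}\le1,$$ we have $$M(\mathcal{F}_D,\mathcal{F}_G)\ge\frac{L_GL_D|Z|}{64A_ZB_Z}=\frac{L_GL_D}{64\left(\sup_{z\in Z}a_z\right)\left(\sup_{z\in Z}b_z\right)} .$$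
   Context: For $f\in L^1(\mathcal{X})$, $\tilde f_z:=\int_{\mathcal{X}} f\phi_z\,d\lambda$; for a Borel probability measure $P$ on $\mathcal{X}$, $\tilde P_z:=\mathbb{E}_{X\sim P}[\phi_z(X)]$, for $z\in\mathcal{Z}$ (the element $p_0$ is not indexed by $\mathcal{Z}$). Generalized ellipses: $\mathcal{H}_{p,a}(L)=\{f\in L^1(\mathcal{X}):(\sum_{z\in\mathcal{Z}}a_z^p|\tilde f_z|^p)^{1/p}\le L\}$. As a discriminator class $\mathcal{F}_D$ it is understood to consist of bounded Borel-measurable functions; as a class $\mathcal{F}_G$ of distributions, $\mathcal{H}_{q,b}(L)$ is the set of Borel probability measures $P$ on $\mathcal{X}$ with $(\sum_{z\in\mathcal{Z}}b_z^q|\tilde P_z|^q)^{1/q}\le L$. Adversarial loss: $d_{\mathcal{F}_D}(P,Q)=\sup_{f\in\mathcal{F}_D}\left|\mathbb{E}_{X\sim P}[f(X)]-\mathbb{E}_{X\sim Q}[f(X)]\right|$. Minimax rate (with sample size $n$): $M(\mathcal{F}_D,\mathcal{F}_G):=\inf_{\widehat P}\sup_{P\in\mathcal{F}_G}\mathbb{E}_{X_{1:n}}\left[d_{\mathcal{F}_D}(P,\widehat P(X_{1:n}))\right]$, where $X_{1:n}=X_1,\dots,X_n$ are i.i.d. with law $P$ and the infimum is over all (potentially randomized) functions $\widehat P:\mathcal{X}^n\to\mathcal{F}_G$. *)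

theory Defs
  imports "HOL-Probability.Probability"
begin

definition unit_cube :: "(real ^ 'd) set" where
  "unit_cube = {x. \<forall>i. 0 \<le> x $ i \<and> x $ i \<le> 1}"

text \<open>Lebesgue measure is taken on the Borel sets of the cube, so that a measurable function can be
  integrated against every Borel probability measure on the cube. Functions on the cube are total
  functions whose values outside the cube are irrelevant.\<close>

definition cube_lebesgue :: "(real ^ 'd) measure" where
  "cube_lebesgue = restrict_space lborel unit_cube"

definition L2_fun :: "'a measure \<Rightarrow> ('a \<Rightarrow> real) set" where
  "L2_fun M = {f \<in> borel_measurable M. integrable M (\<lambda>x. (f x)\<^sup>2)}"

definition orthonormal_basis_L2 :: "'a measure \<Rightarrow> 'i set \<Rightarrow> ('i \<Rightarrow> 'a \<Rightarrow> real) \<Rightarrow> bool" where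
  "orthonormal_basis_L2 M I e \<longleftrightarrow>
     (\<forall>i\<in>I. e i \<in> L2_fun M) \<and>
     (\<forall>i\<in>I. \<forall>j\<in>I. (\<integral>x. e i x * e j x \<partial>M) = (if i = j then 1 else 0)) \<and>
     (\<forall>f\<in>L2_fun M. \<forall>\<epsilon>>0. \<exists>S c. finite S \<and> S \<subseteq> I \<and>
        sqrt (\<integral>x. (f x - (\<Sum>i\<in>S. c i * e i x))\<^sup>2 \<partial>M) < \<epsilon>)"

definition Linf_norm :: "'a measure \<Rightarrow> ('a \<Rightarrow> real) \<Rightarrow> ereal" where
  "Linf_norm M f = esssup M (\<lambda>x. ereal \<bar>f x\<bar>)"

text \<open>The real-valued \<open>infsum\<close> of a divergent family is 0, so finiteness of the weighted
  norm has to be required explicitly.\<close>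

definition in_ellipse :: "'z set \<Rightarrow> real \<Rightarrow> ('z \<Rightarrow> real) \<Rightarrow> real \<Rightarrow> ('z \<Rightarrow> real) \<Rightarrow> bool" where
  "in_ellipse J p a L c \<longleftrightarrow>
     (\<lambda>z. a z powr p * \<bar>c z\<bar> powr p) summable_on J \<and>
     (\<Sum>\<^sub>\<infinity>z\<in>J. a z powr p * \<bar>c z\<bar> powr p) powr (1 / p) \<le> L"

definition ellipse_discriminators ::
  "'z set \<Rightarrow> ('z \<Rightarrow> real ^ 'd \<Rightarrow> real) \<Rightarrow> real \<Rightarrow> ('z \<Rightarrow> real) \<Rightarrow> real \<Rightarrow> (real ^ 'd \<Rightarrow> real) set" where
  "ellipse_discriminators J \<phi> p a L =
     {f \<in> borel_measurable cube_lebesgue. integrable cube_lebesgue f \<and> bounded (f ` unit_cube) \<and>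
        in_ellipse J p a L (\<lambda>z. \<integral>x. f x * \<phi> z x \<partial>cube_lebesgue)}"

definition ellipse_distributions ::
  "'z set \<Rightarrow> ('z \<Rightarrow> real ^ 'd \<Rightarrow> real) \<Rightarrow> real \<Rightarrow> ('z \<Rightarrow> real) \<Rightarrow> real \<Rightarrow> (real ^ 'd) measure set" where
  "ellipse_distributions J \<phi> q b L =
     {P. prob_space P \<and> sets P = sets (restrict_space borel unit_cube) \<and>
        in_ellipse J q b L (\<lambda>z. \<integral>x. \<phi> z x \<partial>P)}"

definition adversarial_loss :: "('a \<Rightarrow> real) set \<Rightarrow> 'a measure \<Rightarrow> 'a measure \<Rightarrow> ennreal" where
  "adversarial_loss FD P Q = (SUP f\<in>FD. ennreal \<bar>(\<integral>x. f x \<partial>P) - (\<integral>x. f x \<partial>Q)\<bar>)"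

text \<open>Estimators are arbitrary, possibly non-measurable functions, so the expected loss is an outer
  expectation, which agrees with the integral for measurable integrands. The integral \<open>nn_integral\<close>
  would be a lower integral on non-measurable integrands.\<close>

definition outer_expectation :: "'a measure \<Rightarrow> ('a \<Rightarrow> ennreal) \<Rightarrow> ennreal" where
  "outer_expectation M f =
     (INF g\<in>{g \<in> borel_measurable M. \<forall>x\<in>space M. f x \<le> g x}. \<integral>\<^sup>+x. g x \<partial>M)"

text \<open>A randomized estimator consists of the law \<open>R\<close> of a random seed, independent of the sample,
  and a function of the sample and the seed. Deterministic estimators are those ignoring the seed.\<close>

definition estimators ::
  "nat \<Rightarrow> 'a set \<Rightarrow> 'a measure set \<Rightarrow> ('w measure \<times> ((nat \<Rightarrow> 'a) \<Rightarrow> 'w \<Rightarrow> 'a measure)) set" where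
  "estimators n X FG =
     {(R, T). prob_space R \<and>
        (\<forall>x \<in> {..<n} \<rightarrow>\<^sub>E X. \<forall>\<omega> \<in> space R. T x \<omega> \<in> FG)}"

definition minimax_rate ::
  "'w itself \<Rightarrow> nat \<Rightarrow> 'a set \<Rightarrow> ('a \<Rightarrow> real) set \<Rightarrow> 'a measure set \<Rightarrow> ennreal" where
  "minimax_rate seed_type n X FD FG =
     (INF (R :: 'w measure, T) \<in> estimators n X FG. SUP P\<in>FG.
        outer_expectation ((\<Pi>\<^sub>M i\<in>{..<n}. P) \<Otimes>\<^sub>M R)
          (\<lambda>(x, \<omega>). adversarial_loss FD P (T x \<omega>)))"

end

theory Submission
  imports Defs
begin

text \<open>Assouad's method over the cube of signs indexed by \<open>Z\<close>, a vertex of which is encoded by the set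
  \<open>S\<close> of its positive coordinates. The hypotheses are the densities \<open>1 + c\<^sub>G \<Sum> \<plusminus>\<phi>\<^sub>z\<close> with
  \<open>c\<^sub>G = L\<^sub>G / B\<^sub>Z\<close>. Testing against the discriminators \<open>c\<^sub>D \<Sum> \<plusminus>\<phi>\<^sub>z\<close>, \<open>c\<^sub>D = L\<^sub>D / A\<^sub>Z\<close>, for all choices of
  signs bounds the loss below by \<open>c\<^sub>D\<close> times the \<open>\<ell>\<^sup>1\<close> distance of the coefficients, which splits into
  one two-point testing problem per coordinate. Densities at adjacent vertices are at least \<open>1/2\<close> and
  differ by \<open>2 c\<^sub>G \<phi>\<^sub>z\<close>, so their Hellinger affinity is at least \<open>1 - c\<^sub>G\<^sup>2\<close>; it tensorizes to
  \<open>(1 - c\<^sub>G\<^sup>2)\<^sup>n \<ge> 7/8\<close>, and no test separates them. The estimator need not be measurable, because it is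
  eliminated pointwise, before integrating.\<close>

section \<open>Product densities and the Hellinger affinity\<close>

lemma PiM_density:
  assumes "finite I" "prob_space M" "prob_space (density M f)" and [measurable]: "f \<in> borel_measurable M"
  shows "PiM I (\<lambda>_. density M f) = density (PiM I (\<lambda>_. M)) (\<lambda>x. \<Prod>i\<in>I. f (x i))"
proof -
  interpret M: prob_space M by fact
  interpret D: prob_space "density M f" by fact
  interpret PM: product_sigma_finite "\<lambda>_. M" ..
  interpret PD: product_sigma_finite "\<lambda>_. density M f" ..
  show ?thesis
  proof (rule PD.PiM_eqI[symmetric])
    fix A assume "\<And>i. i \<in> I \<Longrightarrow> A i \<in> sets (density M f)"
    then have A: "\<And>i. i \<in> I \<Longrightarrow> A i \<in> sets M" by simp
    then have "Pi\<^sub>E I A \<in> sets (PiM I (\<lambda>_. M))"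
      using \<open>finite I\<close> by (auto intro!: sets_PiM_I_finite)
    then have "emeasure (density (PiM I (\<lambda>_. M)) (\<lambda>x. \<Prod>i\<in>I. f (x i))) (Pi\<^sub>E I A) =
        (\<integral>\<^sup>+ x. (\<Prod>i\<in>I. f (x i)) * indicator (Pi\<^sub>E I A) x \<partial>PiM I (\<lambda>_. M))"
      by (subst emeasure_density) auto
    also have "\<dots> = (\<integral>\<^sup>+ x. (\<Prod>i\<in>I. f (x i) * indicator (A i) (x i)) \<partial>PiM I (\<lambda>_. M))"
    proof (rule nn_integral_cong)
      fix x assume "x \<in> space (PiM I (\<lambda>_. M))"
      \<comment> \<open>Extensionality ensures that a point outside the box violates it in some
        coordinate of \<open>I\<close>, where one factor of the product vanishes.\<close>
      then have x: "x \<in> extensional I" by (auto simp: space_PiM PiE_def)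
      have "(indicator (Pi\<^sub>E I A) x :: ennreal) = (\<Prod>i\<in>I. indicator (A i) (x i))"
      proof (cases "x \<in> Pi\<^sub>E I A")
        case True
        then show ?thesis by (auto simp: PiE_def Pi_def)
      next
        case False
        then obtain i where "i \<in> I" "x i \<notin> A i" using x by (auto simp: PiE_def Pi_def)
        then have "(\<Prod>i\<in>I. indicator (A i) (x i)) = (0::ennreal)"
            using \<open>finite I\<close> by (intro prod_zero) (auto intro!: bexI[of _ i])
          then show ?thesis using False by simp
      qed
      then show "(\<Prod>i\<in>I. f (x i)) * indicator (Pi\<^sub>E I A) x = (\<Prod>i\<in>I. f (x i) * indicator (A i) (x i))"
        by (simp add: prod.distrib)
    qed
    also have "\<dots> = (\<Prod>i\<in>I. \<integral>\<^sup>+ x. f x * indicator (A i) x \<partial>M)"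
      using A by (intro PM.product_nn_integral_prod \<open>finite I\<close>) auto
    also have "\<dots> = (\<Prod>i\<in>I. emeasure (density M f) (A i))"
      using A by (intro prod.cong) (auto simp: emeasure_density)
    finally show "emeasure (density (PiM I (\<lambda>_. M)) (\<lambda>x. \<Prod>i\<in>I. f (x i))) (Pi\<^sub>E I A) =
      (\<Prod>i\<in>I. emeasure (density M f) (A i))" .
  qed (use \<open>finite I\<close> in \<open>auto intro!: sets_PiM_cong\<close>)
qed

text \<open>A linear substitute for Cauchy--Schwarz: integrating it with \<open>u\<^sup>2\<close>, \<open>v\<^sup>2\<close> two probability densities bounds the
  integral of their minimum below by the Hellinger affinity.\<close>

lemma hellinger_min_pointwise:
  fixes u v :: real
  shows "4 * (u * v) \<le> 3 * min (u\<^sup>2) (v\<^sup>2) + u\<^sup>2 + v\<^sup>2"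
proof -
  \<comment> \<open>Each square is the gap of the inequality in one of the two cases of
    \<open>min\<close>.\<close>
  have "0 \<le> (2 * u - v)\<^sup>2" "0 \<le> (u - 2 * v)\<^sup>2" by simp_all
  then show ?thesis by (auto simp: min_def power2_eq_square algebra_simps)
qed

text \<open>For \<open>r\<close>, \<open>s\<close> the roots of \<open>f x\<close>,
  \<open>g x\<close>, the arithmetic mean of \<open>f x\<close> and \<open>g x\<close> exceeds
  \<open>r * s\<close> by \<open>(r - s)\<^sup>2 / 2\<close>. Since
  \<open>(r + s) * (r - s) = f x - g x\<close>, and the lower bounds 1/2 give
  \<open>(r + s)\<^sup>2 \<ge> 2\<close>, this excess is at most
  \<open>(f x - g x)\<^sup>2 / 4\<close>.\<close>

lemma hellinger_affinity_ge:
  assumes [measurable]: "f \<in> borel_measurable M" "g \<in> borel_measurable M"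
    and "integrable M f" "integrable M g" "integrable M (\<lambda>x. (f x - g x)\<^sup>2)"
    and "(\<integral>x. f x \<partial>M) = 1" "(\<integral>x. g x \<partial>M) = 1"
    and "AE x in M. 1/2 \<le> f x" "AE x in M. 1/2 \<le> g x"
  shows "(\<integral>\<^sup>+x. ennreal (sqrt (f x) * sqrt (g x)) \<partial>M) \<ge> ennreal (1 - (\<integral>x. (f x - g x)\<^sup>2 \<partial>M) / 4)"
proof -
  have "AE x in M. (f x + g x) / 2 - (f x - g x)\<^sup>2 / 4 \<le> sqrt (f x) * sqrt (g x)"
    using assms(8,9)
  proof eventually_elim
    case (elim x)
    define r s where "r = sqrt (f x)" and "s = sqrt (g x)"
    have rs: "r \<ge> 0" "s \<ge> 0" "f x = r\<^sup>2" "g x = s\<^sup>2" using elim by (auto simp: r_def s_def)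
    have "2 \<le> (r + s)\<^sup>2" if "r * s \<ge> 1/2"
      using that elim rs by (simp add: power2_sum)
    moreover have "(1/2)\<^sup>2 \<le> (r * s)\<^sup>2"
      using mult_mono[of "1/2" "f x" "1/2" "g x"] elim rs by (simp add: power2_eq_square mult_ac)
    then have "r * s \<ge> 1/2" using rs by (meson abs_le_square_iff mult_nonneg_nonneg power2_le_imp_le)
    ultimately have "2 * (r - s)\<^sup>2 \<le> (r + s)\<^sup>2 * (r - s)\<^sup>2"
      by (intro mult_right_mono) auto
    also have "\<dots> = (r\<^sup>2 - s\<^sup>2)\<^sup>2" by (simp add: power2_eq_square algebra_simps)
    finally have "2 * (r - s)\<^sup>2 \<le> (f x - g x)\<^sup>2" using rs by simp
    then have "(f x + g x) / 2 - (f x - g x)\<^sup>2 / 4 \<le> r * s"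
      using rs by (simp add: power2_diff field_simps)
    then show ?case by (simp add: r_def s_def)
  qed
  then have le: "(\<integral>\<^sup>+x. ennreal ((f x + g x) / 2 - (f x - g x)\<^sup>2 / 4) \<partial>M) \<le>
      (\<integral>\<^sup>+x. ennreal (sqrt (f x) * sqrt (g x)) \<partial>M)"
    by (intro nn_integral_mono_AE) (auto intro: ennreal_leI)
  have int: "integrable M (\<lambda>x. (f x + g x) / 2 - (f x - g x)\<^sup>2 / 4)"
    using assms by auto
  have "(\<integral>x. (f x + g x) / 2 - (f x - g x)\<^sup>2 / 4 \<partial>M) = 1 - (\<integral>x. (f x - g x)\<^sup>2 \<partial>M) / 4"
    using assms by simp
  \<comment> \<open>\<open>ennreal\<close> truncates negative values to 0, so the nonnegative
    integral is that of the positive part, which dominates the real integral.\<close>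
  then have "ennreal (1 - (\<integral>x. (f x - g x)\<^sup>2 \<partial>M) / 4)
      \<le> ennreal (\<integral>x. max 0 ((f x + g x) / 2 - (f x - g x)\<^sup>2 / 4) \<partial>M)"
    using int integral_mono[OF int, of "\<lambda>x. max 0 ((f x + g x) / 2 - (f x - g x)\<^sup>2 / 4)"]
    by (intro ennreal_leI) (auto intro: integrable_max)
  also have "\<dots> = (\<integral>\<^sup>+x. ennreal (max 0 ((f x + g x) / 2 - (f x - g x)\<^sup>2 / 4)) \<partial>M)"
    using int by (intro nn_integral_eq_integral[symmetric]) (auto intro!: integrable_max)
  also have "\<dots> = (\<integral>\<^sup>+x. ennreal ((f x + g x) / 2 - (f x - g x)\<^sup>2 / 4) \<partial>M)"
    by (simp add: max.commute)
  finally show ?thesis using le by simp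
qed

text \<open>The likelihood of an i.i.d. sample of size \<open>n\<close>: for a probability density
  \<open>h\<close> it is the density of the product law, by \<open>PiM_density\<close>.\<close>

definition pow_density :: "nat \<Rightarrow> ('a \<Rightarrow> real) \<Rightarrow> (nat \<Rightarrow> 'a) \<Rightarrow> ennreal" where
  "pow_density n h x = (\<Prod>i<n. ennreal (h (x i)))"

lemma measurable_pow_density [measurable (raw)]:
  "h \<in> borel_measurable M \<Longrightarrow> pow_density n h \<in> borel_measurable (PiM {..<n} (\<lambda>_. M))"
  unfolding pow_density_def
  by (intro borel_measurable_prod_ennreal) (auto intro!: measurable_compose[OF measurable_component_singleton])

text \<open>The integral of the minimum is the least sum of the two error probabilities of a test
  between the sample laws. The affinity factorizes over the sample, so integrating
  \<open>hellinger_min_pointwise\<close> at the roots of the likelihoods gives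
  \<open>4 * \<rho> ^ n \<le> 3 * I + 2\<close>; the threshold 7/8 turns this into
  \<open>I \<ge> 1/2\<close>.\<close>

lemma nn_integral_min_pow_density_ge:
  assumes "prob_space M" and [measurable]: "f \<in> borel_measurable M" "g \<in> borel_measurable M"
    and "\<And>x. f x \<ge> 0" "\<And>x. g x \<ge> 0"
    and "(\<integral>\<^sup>+x. ennreal (f x) \<partial>M) = 1" "(\<integral>\<^sup>+x. ennreal (g x) \<partial>M) = 1"
    and rho: "ennreal \<rho> \<le> (\<integral>\<^sup>+x. ennreal (sqrt (f x) * sqrt (g x)) \<partial>M)" and "\<rho> \<ge> 0" "7/8 \<le> \<rho> ^ n"
  shows "ennreal (1/2) \<le> (\<integral>\<^sup>+x. min (pow_density n f x) (pow_density n g x) \<partial>PiM {..<n} (\<lambda>_. M))"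
proof -
  interpret M: prob_space M by fact
  interpret PM: product_sigma_finite "\<lambda>_. M" ..
  let ?P = "PiM {..<n} (\<lambda>_. M)"
  define I where "I = (\<integral>\<^sup>+x. min (pow_density n f x) (pow_density n g x) \<partial>?P)"
  have one: "(\<integral>\<^sup>+x. pow_density n f x \<partial>?P) = 1" "(\<integral>\<^sup>+x. pow_density n g x \<partial>?P) = 1"
    unfolding pow_density_def using assms by (subst PM.product_nn_integral_prod; auto)+
  have "4 * ennreal (7/8) \<le> 4 * (ennreal \<rho>) ^ n"
    using assms by (intro mult_left_mono) (auto simp: ennreal_power intro!: ennreal_leI)
  also have "\<dots> \<le> 4 * (\<integral>\<^sup>+x. ennreal (sqrt (f x) * sqrt (g x)) \<partial>M) ^ n"
    using rho by (intro mult_left_mono power_mono) auto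
  also have "\<dots> = 4 * (\<integral>\<^sup>+x. (\<Prod>i<n. ennreal (sqrt (f (x i)) * sqrt (g (x i)))) \<partial>?P)"
    by (subst PM.product_nn_integral_prod) auto
  also have "\<dots> = (\<integral>\<^sup>+x. 4 * (\<Prod>i<n. ennreal (sqrt (f (x i)) * sqrt (g (x i)))) \<partial>?P)"
    by (subst nn_integral_cmult) auto
  also have "\<dots> \<le> (\<integral>\<^sup>+x. 3 * min (pow_density n f x) (pow_density n g x)
                      + pow_density n f x + pow_density n g x \<partial>?P)"
  proof (rule nn_integral_mono)
    fix x assume "x \<in> space ?P"
    define u v where "u = (\<Prod>i<n. sqrt (f (x i)))" and "v = (\<Prod>i<n. sqrt (g (x i)))"
    have uv: "u \<ge> 0" "v \<ge> 0" using assms by (auto simp: u_def v_def intro!: prod_nonneg)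
    have f: "pow_density n f x = ennreal (u\<^sup>2)" and g: "pow_density n g x = ennreal (v\<^sup>2)"
      using assms by (simp_all add: pow_density_def u_def v_def prod_power_distrib prod_ennreal)
    have "(\<Prod>i<n. ennreal (sqrt (f (x i)) * sqrt (g (x i)))) = ennreal (u * v)"
      using assms by (simp add: prod_ennreal u_def v_def prod.distrib)
    moreover have "4 * ennreal (u * v) = ennreal (4 * (u * v))"
      using uv by (simp add: ennreal_mult)
    moreover have "3 * min (ennreal (u\<^sup>2)) (ennreal (v\<^sup>2)) + ennreal (u\<^sup>2) + ennreal (v\<^sup>2) =
        ennreal (3 * min (u\<^sup>2) (v\<^sup>2) + u\<^sup>2 + v\<^sup>2)"
      by (auto simp: ennreal_mult min_def)
    ultimately show "4 * (\<Prod>i<n. ennreal (sqrt (f (x i)) * sqrt (g (x i)))) \<le>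
        3 * min (pow_density n f x) (pow_density n g x) + pow_density n f x + pow_density n g x"
      unfolding f g using ennreal_leI[OF hellinger_min_pointwise[of u v]] by simp
  qed
  also have "\<dots> = 3 * I + 2"
    unfolding I_def by (simp add: nn_integral_add nn_integral_cmult one add.assoc)
  finally have *: "4 * ennreal (7/8) \<le> 3 * I + 2" .
  have "ennreal (1/2) \<le> I"
  proof (cases I)
    case (real r)
    have "4 * ennreal (7/8) = ennreal (7/2)"
      using ennreal_mult[of 4 "7/8"] by simp
    moreover have "3 * ennreal r + 2 = ennreal (3 * r + 2)"
      using real by (simp add: ennreal_mult add.commute)
    ultimately have "7/2 \<le> 3 * r + 2"
      using * real by (metis ennreal_le_iff add_nonneg_nonneg mult_nonneg_nonneg zero_le_numeral)
    then have "1/2 \<le> r" by simp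
    then show ?thesis unfolding real by (rule ennreal_leI)
  qed auto
  then show ?thesis unfolding I_def .
qed

section \<open>Assouad's lemma on the cube of signs\<close>

definition sign_at :: "'z set \<Rightarrow> 'z \<Rightarrow> real" where
  "sign_at S z = (if z \<in> S then 1 else - 1)"

text \<open>Symmetric difference makes the change of sign at \<open>z \<in> Z\<close> an involution
  of \<open>Pow Z\<close>, which pairs adjacent vertices.\<close>

abbreviation flip :: "'z \<Rightarrow> 'z set \<Rightarrow> 'z set" where
  "flip z S \<equiv> sym_diff S {z}"

lemma sign_at_flip: "sign_at (flip z S) y = (if y = z then - sign_at S y else sign_at S y)"
  by (auto simp: sign_at_def)

lemma sum_Pow_flip:
  assumes "z \<in> Z"
  shows "(\<Sum>S\<in>Pow Z. F (flip z S)) = (\<Sum>S\<in>Pow Z. F S)"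
  by (rule sum.reindex_bij_witness[of _ "flip z" "flip z"]) (use assms in auto)

text \<open>At a fixed observation, \<open>\<mu> S\<close> is the likelihood of the vertex
  \<open>S\<close> and \<open>t\<close> the estimate. The distances of \<open>t z\<close> from 1 and
  -1 add up to at least 2, so twice the smaller weight of \<open>S\<close> and
  \<open>flip z S\<close> is paid for by the two weighted distances together. Summing over
  \<open>Pow Z\<close> counts every vertex twice, and the factor 2 cancels.\<close>

lemma assouad_pointwise:
  fixes \<mu> :: "'z set \<Rightarrow> ennreal" and t :: "'z \<Rightarrow> real" and \<kappa> :: real
  assumes "\<kappa> \<ge> 0"
  shows "ennreal \<kappa> * (\<Sum>z\<in>Z. \<Sum>S\<in>Pow Z. min (\<mu> S) (\<mu> (flip z S)))
      \<le> (\<Sum>S\<in>Pow Z. \<mu> S * ennreal (\<kappa> * (\<Sum>z\<in>Z. \<bar>sign_at S z - t z\<bar>)))"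
proof -
  have "(\<Sum>S\<in>Pow Z. min (\<mu> S) (\<mu> (flip z S))) \<le> (\<Sum>S\<in>Pow Z. \<mu> S * ennreal \<bar>sign_at S z - t z\<bar>)"
    if "z \<in> Z" for z
  proof -
    have "2 * (\<Sum>S\<in>Pow Z. min (\<mu> S) (\<mu> (flip z S))) = (\<Sum>S\<in>Pow Z. min (\<mu> S) (\<mu> (flip z S)) * 2)"
      by (subst mult.commute) (rule sum_distrib_right)
    also have "\<dots> \<le> (\<Sum>S\<in>Pow Z. \<mu> S * ennreal \<bar>sign_at S z - t z\<bar>
                      + \<mu> (flip z S) * ennreal \<bar>sign_at (flip z S) z - t z\<bar>)"
    proof (rule sum_mono)
      fix S
      let ?m = "min (\<mu> S) (\<mu> (flip z S))"
      have "ennreal 2 \<le> ennreal (\<bar>sign_at S z - t z\<bar> + \<bar>sign_at (flip z S) z - t z\<bar>)"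
        by (intro ennreal_leI) (auto simp: sign_at_def)
      then have "?m * 2 \<le> ?m * (ennreal \<bar>sign_at S z - t z\<bar> + ennreal \<bar>sign_at (flip z S) z - t z\<bar>)"
        by (intro mult_left_mono) auto
      also have "\<dots> \<le> \<mu> S * ennreal \<bar>sign_at S z - t z\<bar> +
                         \<mu> (flip z S) * ennreal \<bar>sign_at (flip z S) z - t z\<bar>"
        unfolding distrib_left by (intro add_mono mult_right_mono) auto
      finally show "?m * 2 \<le> \<dots>" .
    qed
    also have "\<dots> = 2 * (\<Sum>S\<in>Pow Z. \<mu> S * ennreal \<bar>sign_at S z - t z\<bar>)"
      using sum_Pow_flip[OF that, of "\<lambda>S. \<mu> S * ennreal \<bar>sign_at S z - t z\<bar>"]
      by (simp add: sum.distrib mult_2)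
    finally show ?thesis by (simp add: ennreal_mult_le_mult_iff)
  qed
  then have "(\<Sum>z\<in>Z. \<Sum>S\<in>Pow Z. min (\<mu> S) (\<mu> (flip z S)))
      \<le> (\<Sum>z\<in>Z. \<Sum>S\<in>Pow Z. \<mu> S * ennreal \<bar>sign_at S z - t z\<bar>)"
    by (rule sum_mono)
  also have "\<dots> = (\<Sum>S\<in>Pow Z. \<Sum>z\<in>Z. \<mu> S * ennreal \<bar>sign_at S z - t z\<bar>)"
    by (rule sum.swap)
  finally have "ennreal \<kappa> * (\<Sum>z\<in>Z. \<Sum>S\<in>Pow Z. min (\<mu> S) (\<mu> (flip z S)))
      \<le> ennreal \<kappa> * (\<Sum>S\<in>Pow Z. \<Sum>z\<in>Z. \<mu> S * ennreal \<bar>sign_at S z - t z\<bar>)"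
    by (rule mult_left_mono) simp
  also have "\<dots> = (\<Sum>S\<in>Pow Z. \<mu> S * ennreal (\<kappa> * (\<Sum>z\<in>Z. \<bar>sign_at S z - t z\<bar>)))"
    unfolding sum_distrib_left[of "ennreal \<kappa>" _ "Pow Z"]
  proof (rule sum.cong[OF refl])
    fix S
    have "(\<Sum>z\<in>Z. \<mu> S * ennreal \<bar>sign_at S z - t z\<bar>) = \<mu> S * ennreal (\<Sum>z\<in>Z. \<bar>sign_at S z - t z\<bar>)"
      unfolding sum_distrib_left[symmetric] by (subst sum_ennreal) auto
    then show "ennreal \<kappa> * (\<Sum>z\<in>Z. \<mu> S * ennreal \<bar>sign_at S z - t z\<bar>)
        = \<mu> S * ennreal (\<kappa> * (\<Sum>z\<in>Z. \<bar>sign_at S z - t z\<bar>))"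
      using \<open>\<kappa> \<ge> 0\<close> by (simp add: ennreal_mult sum_nonneg mult.left_commute)
  qed
  finally show ?thesis .
qed

text \<open>The largest risk is at least the average over all vertices. Once every law is a density
  over the one measure \<open>PiM {..<n} (\<lambda>_. M) \<Otimes>\<^sub>M R\<close>, the sum of the
  risks is a single integral, to which \<open>assouad_pointwise\<close> applies under the integral
  sign.\<close>

lemma assouad:
  fixes h :: "'z set \<Rightarrow> 'a \<Rightarrow> real" and R :: "'w measure"
    and l :: "'z set \<Rightarrow> (nat \<Rightarrow> 'a) \<times> 'w \<Rightarrow> ennreal" and t :: "'z \<Rightarrow> (nat \<Rightarrow> 'a) \<times> 'w \<Rightarrow> real"
  assumes "prob_space M" "prob_space R" "finite Z" "\<kappa> \<ge> 0"
    and h_meas [measurable]: "\<And>S. h S \<in> borel_measurable M"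
    and h_one: "\<And>S. S \<subseteq> Z \<Longrightarrow> (\<integral>\<^sup>+x. ennreal (h S x) \<partial>M) = 1"
    and affinity: "\<And>S z. S \<subseteq> Z \<Longrightarrow> z \<in> Z \<Longrightarrow>
      \<eta> \<le> (\<integral>\<^sup>+x. min (pow_density n (h S) x) (pow_density n (h (flip z S)) x) \<partial>PiM {..<n} (\<lambda>_. M))"
    and loss: "\<And>S y. S \<subseteq> Z \<Longrightarrow> y \<in> space (PiM {..<n} (\<lambda>_. M) \<Otimes>\<^sub>M R) \<Longrightarrow>
      ennreal (\<kappa> * (\<Sum>z\<in>Z. \<bar>sign_at S z - t z y\<bar>)) \<le> l S y"
  shows "ennreal \<kappa> * of_nat (card Z) * \<eta> \<le>
    (SUP S\<in>Pow Z. outer_expectation (PiM {..<n} (\<lambda>_. density M (\<lambda>x. ennreal (h S x))) \<Otimes>\<^sub>M R) (l S))"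
proof -
  interpret M: prob_space M by fact
  interpret R: prob_space R by fact
  let ?P = "PiM {..<n} (\<lambda>_. M)" and ?N = "PiM {..<n} (\<lambda>_. M) \<Otimes>\<^sub>M R"
  let ?D = "\<lambda>S. PiM {..<n} (\<lambda>_. density M (\<lambda>x. ennreal (h S x))) \<Otimes>\<^sub>M R"
  let ?w = "\<lambda>S (y :: (nat \<Rightarrow> 'a) \<times> 'w). pow_density n (h S) (fst y)"
  have D: "?D S = density ?N (?w S)" if "S \<subseteq> Z" for S
  proof -
    have "prob_space (density M (\<lambda>x. ennreal (h S x)))"
      using h_one[OF that] by (intro prob_spaceI) (simp add: emeasure_density)
    then have "PiM {..<n} (\<lambda>_. density M (\<lambda>x. ennreal (h S x))) = density ?P (pow_density n (h S))"
      unfolding pow_density_def by (intro PiM_density) (auto simp: M.prob_space_axioms)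
    \<comment> \<open>The seed law is written with density 1 so that the product rule for densities
      applies.\<close>
    moreover have "density ?P (pow_density n (h S)) \<Otimes>\<^sub>M density R (\<lambda>_. 1) =
        density ?N (\<lambda>(x, y). pow_density n (h S) x * 1)"
      by (intro pair_measure_density) (auto simp: density_1 R.sigma_finite_measure)
    ultimately show ?thesis by (simp add: density_1 case_prod_beta')
  qed
  \<comment> \<open>Outer expectations are handled through measurable majorants \<open>g S\<close>
    of the losses. The estimate \<open>t\<close> enters only pointwise, so everything integrated is
    measurable.\<close>
  have lower: "ennreal \<kappa> * of_nat (card Z) * \<eta> * of_nat (card (Pow Z)) \<le> (\<Sum>S\<in>Pow Z. \<integral>\<^sup>+y. g S y \<partial>?D S)"
    if g: "\<And>S. S \<subseteq> Z \<Longrightarrow> g S \<in> borel_measurable ?N"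
      and lg: "\<And>S y. S \<subseteq> Z \<Longrightarrow> y \<in> space ?N \<Longrightarrow> l S y \<le> g S y" for g
  proof -
    have [measurable]: "(\<lambda>y. pow_density n (h S) (fst y)) \<in> borel_measurable ?N" for S
      by (rule measurable_compose[OF measurable_fst]) measurable
    have min_fst: "(\<integral>\<^sup>+y. min (?w S y) (?w (flip z S) y) \<partial>?N) =
        (\<integral>\<^sup>+x. min (pow_density n (h S) x) (pow_density n (h (flip z S)) x) \<partial>?P)" for S z
      by (subst R.nn_integral_fst[symmetric]) (auto simp: R.emeasure_space_1)
    have "ennreal \<kappa> * of_nat (card Z) * \<eta> * of_nat (card (Pow Z)) = ennreal \<kappa> * (\<Sum>z\<in>Z. \<Sum>S\<in>Pow Z. \<eta>)"
      by (simp add: mult_ac)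
    also have "\<dots> \<le> ennreal \<kappa> * (\<Sum>z\<in>Z. \<Sum>S\<in>Pow Z. \<integral>\<^sup>+y. min (?w S y) (?w (flip z S) y) \<partial>?N)"
      unfolding min_fst by (intro mult_left_mono sum_mono affinity) auto
    also have "\<dots> = (\<integral>\<^sup>+y. ennreal \<kappa> * (\<Sum>z\<in>Z. \<Sum>S\<in>Pow Z. min (?w S y) (?w (flip z S) y)) \<partial>?N)"
      by (simp add: nn_integral_cmult nn_integral_sum)
    also have "\<dots> \<le> (\<integral>\<^sup>+y. (\<Sum>S\<in>Pow Z. ?w S y * g S y) \<partial>?N)"
    proof (rule nn_integral_mono)
      fix y assume y: "y \<in> space ?N"
      have "(\<Sum>S\<in>Pow Z. ?w S y * ennreal (\<kappa> * (\<Sum>z\<in>Z. \<bar>sign_at S z - t z y\<bar>))) \<le> (\<Sum>S\<in>Pow Z. ?w S y * g S y)"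
        using order_trans[OF loss lg] y by (intro sum_mono mult_left_mono) auto
      then show "ennreal \<kappa> * (\<Sum>z\<in>Z. \<Sum>S\<in>Pow Z. min (?w S y) (?w (flip z S) y)) \<le> (\<Sum>S\<in>Pow Z. ?w S y * g S y)"
        using assouad_pointwise[OF \<open>\<kappa> \<ge> 0\<close>, where \<mu> = "\<lambda>S. ?w S y" and t = "\<lambda>z. t z y"] by (rule order_trans[rotated])
    qed
    also have "\<dots> = (\<Sum>S\<in>Pow Z. \<integral>\<^sup>+y. ?w S y * g S y \<partial>?N)"
      using g by (intro nn_integral_sum) auto
    also have "\<dots> = (\<Sum>S\<in>Pow Z. \<integral>\<^sup>+y. g S y \<partial>?D S)"
      using g D by (intro sum.cong) (auto simp: nn_integral_density)
    finally show ?thesis .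
  qed
  have fin: "finite (Pow Z)" "Pow Z \<noteq> {}" "card (Pow Z) > 0"
    using \<open>finite Z\<close> by (auto simp: card_gt_0_iff)
  let ?V = "SUP S\<in>Pow Z. outer_expectation (?D S) (l S)"
  show ?thesis
  proof (rule ccontr)
    assume "\<not> ?thesis"
    then have V: "?V < ennreal \<kappa> * of_nat (card Z) * \<eta>" by simp
    \<comment> \<open>The infimum in an outer expectation need not be attained, but below the
      claimed bound every vertex has a majorant with integral strictly below it. There are finitely
      many vertices, so even the largest of these integrals stays strictly below, contradicting
      \<open>lower\<close>.\<close>
    have "\<exists>g\<in>borel_measurable ?N. (\<forall>y\<in>space ?N. l S y \<le> g y) \<and> (\<integral>\<^sup>+y. g y \<partial>?D S) < ennreal \<kappa> * of_nat (card Z) * \<eta>"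
      if "S \<subseteq> Z" for S
    proof -
      have "outer_expectation (?D S) (l S) < ennreal \<kappa> * of_nat (card Z) * \<eta>"
        using that by (intro le_less_trans[OF _ V] SUP_upper) auto
      then show ?thesis
        unfolding outer_expectation_def INF_less_iff D[OF that] by auto
    qed
    then obtain g where g: "\<And>S. S \<subseteq> Z \<Longrightarrow> g S \<in> borel_measurable ?N"
      "\<And>S y. S \<subseteq> Z \<Longrightarrow> y \<in> space ?N \<Longrightarrow> l S y \<le> g S y"
      "\<And>S. S \<subseteq> Z \<Longrightarrow> (\<integral>\<^sup>+y. g S y \<partial>?D S) < ennreal \<kappa> * of_nat (card Z) * \<eta>"
      by metis
    let ?m = "Max ((\<lambda>S. \<integral>\<^sup>+y. g S y \<partial>?D S) ` Pow Z)"
    have "of_nat (card (Pow Z)) * (ennreal \<kappa> * of_nat (card Z) * \<eta>) \<le> (\<Sum>S\<in>Pow Z. \<integral>\<^sup>+y. g S y \<partial>?D S)"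
      using lower[OF g(1,2)] by (simp add: mult.commute)
    also have "\<dots> \<le> of_nat (card (Pow Z)) * ?m"
      using fin by (intro sum_bounded_above Max_ge) auto
    finally have "ennreal \<kappa> * of_nat (card Z) * \<eta> \<le> ?m"
      using fin by (subst (asm) ennreal_mult_le_mult_iff) (auto simp: of_nat_less_top less_top[symmetric])
    moreover have "?m < ennreal \<kappa> * of_nat (card Z) * \<eta>"
      using fin g(3) by (subst Max_less_iff) auto
    ultimately show False by simp
  qed
qed

section \<open>Ellipse membership, sup norms and integrability\<close>

lemma abs_sign_at [simp]: "\<bar>sign_at S z\<bar> = 1" and sign_at_mult_self [simp]: "sign_at S z * sign_at S z = 1"
  by (simp_all add: sign_at_def)

text \<open>The weighted norm is at most \<open>real (card Z) powr (1/p) * (\<alpha> * s)\<close>.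
  Because \<open>p \<ge> 2\<close> and \<open>Z\<close> is nonempty, the exponent may be raised to
  1/2; this is the source of the square root in \<open>A\<^sub>Z\<close> and
  \<open>B\<^sub>Z\<close>, whatever \<open>p\<close> and \<open>q\<close> are.\<close>

lemma in_ellipse_finite_support:
  assumes "finite Z" "Z \<noteq> {}" "Z \<subseteq> J" "p \<ge> 2" "s \<ge> 0"
    and "\<And>z. z \<in> Z \<Longrightarrow> 0 \<le> a z" "\<And>z. z \<in> Z \<Longrightarrow> a z \<le> \<alpha>"
    and "\<And>z. z \<in> Z \<Longrightarrow> \<bar>c z\<bar> = s" "\<And>z. z \<in> J - Z \<Longrightarrow> c z = 0"
    and "sqrt (real (card Z)) * \<alpha> * s \<le> L"
  shows "in_ellipse J p a L c"
proof -
  let ?f = "\<lambda>z. a z powr p * \<bar>c z\<bar> powr p"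
  have N: "real (card Z) \<ge> 1" using assms by (simp add: Suc_leI card_gt_0_iff)
  obtain z0 where "z0 \<in> Z" using \<open>Z \<noteq> {}\<close> by blast
  then have "\<alpha> \<ge> 0" using assms(6,7) by force
  have zero: "?f z = 0" if "z \<in> J - Z" for z using assms(9)[OF that] by simp
  have "?f summable_on J \<longleftrightarrow> ?f summable_on Z" "infsum ?f J = infsum ?f Z"
    by (rule summable_on_cong_neutral infsum_cong_neutral; use zero \<open>Z \<subseteq> J\<close> in auto)+
  then have sum: "?f summable_on J" and inf: "infsum ?f J = sum ?f Z"
    using \<open>finite Z\<close> by auto
  have "sum ?f Z \<le> (\<Sum>z\<in>Z. \<alpha> powr p * s powr p)"
    using assms by (intro sum_mono mult_mono powr_mono2) auto
  also have "\<dots> = real (card Z) * (\<alpha> * s) powr p"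
    using \<open>\<alpha> \<ge> 0\<close> \<open>s \<ge> 0\<close> by (simp add: powr_mult)
  finally have "sum ?f Z powr (1/p) \<le> (real (card Z) * (\<alpha> * s) powr p) powr (1/p)"
    using \<open>p \<ge> 2\<close> by (intro powr_mono2) (auto intro: sum_nonneg)
  also have "\<dots> = real (card Z) powr (1/p) * (\<alpha> * s)"
    using \<open>p \<ge> 2\<close> \<open>\<alpha> \<ge> 0\<close> \<open>s \<ge> 0\<close> by (simp add: powr_mult powr_powr)
  also have "\<dots> \<le> real (card Z) powr (1/2) * (\<alpha> * s)"
    using \<open>p \<ge> 2\<close> \<open>\<alpha> \<ge> 0\<close> \<open>s \<ge> 0\<close> N by (intro mult_right_mono powr_mono) (auto simp: field_simps)
  also have "\<dots> \<le> L" using assms(10) by (simp add: powr_half_sqrt mult.assoc)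
  finally show ?thesis using sum inf by (simp add: in_ellipse_def)
qed

text \<open>Off a null set each function is below its essential supremum, and a finite union of null
  sets is null.\<close>

lemma AE_weighted_sum_le_of_Linf:
  assumes "c \<ge> 0" "finite Z" "ereal c * (\<Sum>z\<in>Z. Linf_norm M (f z)) \<le> 1"
  shows "AE x in M. c * (\<Sum>z\<in>Z. \<bar>f z x\<bar>) \<le> 1"
proof -
  have "AE x in M. \<forall>z\<in>Z. ereal \<bar>f z x\<bar> \<le> Linf_norm M (f z)"
    unfolding Linf_norm_def using \<open>finite Z\<close> by (intro AE_finite_allI esssup_AE)
  then show ?thesis
  proof eventually_elim
    case (elim x)
    have "ereal (c * (\<Sum>z\<in>Z. \<bar>f z x\<bar>)) = ereal c * (\<Sum>z\<in>Z. ereal \<bar>f z x\<bar>)"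
      by (simp add: sum_ereal)
    also have "\<dots> \<le> ereal c * (\<Sum>z\<in>Z. Linf_norm M (f z))"
      using elim \<open>c \<ge> 0\<close> by (intro ereal_mult_left_mono sum_mono) auto
    finally have "ereal (c * (\<Sum>z\<in>Z. \<bar>f z x\<bar>)) \<le> 1"
      using assms(3) by (rule order_trans)
    then show ?case by (simp add: one_ereal_def)
  qed
qed

lemma integrable_bounded_prob:
  fixes f :: "'a \<Rightarrow> real"
  assumes "prob_space M" "f \<in> borel_measurable M" "bounded (f ` space M)"
  shows "integrable M f"
proof -
  interpret prob_space M by fact
  obtain B where "\<And>x. x \<in> space M \<Longrightarrow> norm (f x) \<le> B"
    using assms(3) by (auto simp: bounded_iff)
  then show ?thesis using assms(2) by (intro integrable_const_bound[of _ B]) auto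
qed

section \<open>Hypotheses built from finitely many basis functions\<close>

text \<open>\<open>M\<close> is the uniform law, so \<open>mean0\<close> is orthogonality to the
  constant density; \<open>c\<close> is the size of the perturbation.\<close>

locale bounded_orthonormal_system = prob_space M for M :: "'a measure" +
  fixes Z :: "'z set" and \<phi> :: "'z \<Rightarrow> 'a \<Rightarrow> real" and c :: real
  assumes finite_Z: "finite Z"
    and meas: "\<And>z. z \<in> Z \<Longrightarrow> \<phi> z \<in> borel_measurable M"
    and bounded: "\<And>z. z \<in> Z \<Longrightarrow> bounded (\<phi> z ` space M)"
    and mean0: "\<And>z. z \<in> Z \<Longrightarrow> (\<integral>x. \<phi> z x \<partial>M) = 0"
    and ortho: "\<And>z w. z \<in> Z \<Longrightarrow> w \<in> Z \<Longrightarrow> (\<integral>x. \<phi> z x * \<phi> w x \<partial>M) = (if z = w then 1 else 0)"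
    and c_nonneg: "c \<ge> 0"
    and small: "AE x in M. 2 * c * (\<Sum>z\<in>Z. \<bar>\<phi> z x\<bar>) \<le> 1"
begin

text \<open>Scaled by \<open>c\<close> it perturbs the uniform density; with another scale it is the
  discriminator.\<close>

definition signed_sum :: "'z set \<Rightarrow> 'a \<Rightarrow> real" where
  "signed_sum S x = (\<Sum>z\<in>Z. sign_at S z * \<phi> z x)"

text \<open>The truncation at 0 is vacuous almost everywhere; it makes \<open>hyp S\<close> nonnegative everywhere.\<close>

definition hyp :: "'z set \<Rightarrow> 'a \<Rightarrow> real" where
  "hyp S x = max 0 (1 + c * signed_sum S x)"

lemma measurable_signed_sum [measurable]: "signed_sum S \<in> borel_measurable M"
  unfolding signed_sum_def using meas by measurable

lemma measurable_hyp [measurable]: "hyp S \<in> borel_measurable M"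
  unfolding hyp_def by measurable

lemma bounded_signed_sum: "bounded (signed_sum S ` space M)"
proof -
  from bounded obtain B where B: "\<And>z x. z \<in> Z \<Longrightarrow> x \<in> space M \<Longrightarrow> \<bar>\<phi> z x\<bar> \<le> B z"
    unfolding bounded_iff by simp metis
  have "\<bar>signed_sum S x\<bar> \<le> (\<Sum>z\<in>Z. B z)" if "x \<in> space M" for x
    unfolding signed_sum_def using B that
    by (intro order_trans[OF sum_abs] sum_mono) (simp add: abs_mult)
  then show ?thesis by (auto simp: bounded_iff)
qed

lemma integrable_phi: "z \<in> Z \<Longrightarrow> integrable M (\<phi> z)"
  using integrable_bounded_prob[OF prob_space_axioms] meas bounded by blast

lemma integrable_signed_sum: "integrable M (signed_sum S)"
  by (rule integrable_bounded_prob[OF prob_space_axioms measurable_signed_sum bounded_signed_sum])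

lemma integrable_mult_bounded:
  fixes f g :: "'a \<Rightarrow> real"
  assumes "f \<in> borel_measurable M" "g \<in> borel_measurable M" "bounded (f ` space M)" "bounded (g ` space M)"
  shows "integrable M (\<lambda>x. f x * g x)"
proof (rule integrable_bounded_prob[OF prob_space_axioms])
  obtain A B where "\<And>x. x \<in> space M \<Longrightarrow> \<bar>f x\<bar> \<le> A" "\<And>x. x \<in> space M \<Longrightarrow> \<bar>g x\<bar> \<le> B"
    using assms(3,4) by (auto simp: bounded_iff)
  then have "\<bar>f x * g x\<bar> \<le> A * B" if "x \<in> space M" for x
    using that unfolding abs_mult by (intro mult_mono) (auto intro: order_trans[OF abs_ge_zero])
  then show "bounded ((\<lambda>x. f x * g x) ` space M)" by (auto simp: bounded_iff)
qed (use assms in measurable)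

lemma integral_signed_sum: "(\<integral>x. signed_sum S x \<partial>M) = 0"
  unfolding signed_sum_def using integrable_phi mean0 by (simp add: Bochner_Integration.integral_sum)

text \<open>The factor 2 in \<open>small\<close> keeps the perturbation within 1/2 in absolute
  value, which makes the truncation vacuous and supplies the lower bound that
  \<open>hellinger_affinity_ge\<close> asks for.\<close>

lemma AE_hyp: "AE x in M. hyp S x = 1 + c * signed_sum S x \<and> 1/2 \<le> hyp S x"
  using small
proof eventually_elim
  case (elim x)
  have "\<bar>c * signed_sum S x\<bar> \<le> c * (\<Sum>z\<in>Z. \<bar>\<phi> z x\<bar>)"
    unfolding signed_sum_def abs_mult using c_nonneg
    by (intro mult_mono order_trans[OF sum_abs] sum_mono) (auto simp: abs_mult sum_nonneg)
  then have "\<bar>c * signed_sum S x\<bar> \<le> 1/2" using elim by simp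
  then show ?case unfolding hyp_def by linarith
qed

lemma integral_signed_sum_mult:
  assumes "g \<in> borel_measurable M" "bounded (g ` space M)"
  shows "(\<integral>x. signed_sum S x * g x \<partial>M) = (\<Sum>z\<in>Z. sign_at S z * (\<integral>x. \<phi> z x * g x \<partial>M))"
  unfolding signed_sum_def sum_distrib_right mult.assoc
  using integrable_mult_bounded[OF meas assms(1) bounded assms(2)]
  by (simp add: Bochner_Integration.integral_sum)

text \<open>With \<open>g\<close> a basis function this reads off the coefficients of a
  hypothesis.\<close>

lemma integral_hyp_mult:
  assumes [measurable]: "g \<in> borel_measurable M" and "bounded (g ` space M)"
  shows "(\<integral>x. g x \<partial>density M (\<lambda>x. ennreal (hyp S x))) = (\<integral>x. g x \<partial>M) + c * (\<integral>x. signed_sum S x * g x \<partial>M)"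
proof -
  have "(\<integral>x. g x \<partial>density M (\<lambda>x. ennreal (hyp S x))) = (\<integral>x. hyp S x * g x \<partial>M)"
    by (subst integral_density) (auto simp: hyp_def)
  also have "\<dots> = (\<integral>x. g x + c * (signed_sum S x * g x) \<partial>M)"
    by (intro integral_cong_AE) (use AE_hyp[of S] in \<open>auto simp: algebra_simps\<close>)
  also have "\<dots> = (\<integral>x. g x \<partial>M) + c * (\<integral>x. signed_sum S x * g x \<partial>M)"
    using integrable_mult_bounded[OF measurable_signed_sum assms(1) bounded_signed_sum assms(2)]
      integrable_bounded_prob[OF prob_space_axioms assms]
    by simp
  finally show ?thesis .
qed

lemma integrable_hyp: "integrable M (hyp S)" and integral_hyp: "(\<integral>x. hyp S x \<partial>M) = 1"
proof -
  have AE: "AE x in M. hyp S x = 1 + c * signed_sum S x" using AE_hyp[of S] by auto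
  have *: "integrable M (\<lambda>x. 1 + c * signed_sum S x)" using integrable_signed_sum by auto
  show "integrable M (hyp S)"
    by (subst integrable_cong_AE[OF _ _ AE]) (use * in auto)
  show "(\<integral>x. hyp S x \<partial>M) = 1"
    by (subst integral_cong_AE[OF _ _ AE])
      (use * integrable_signed_sum integral_signed_sum in \<open>auto simp: prob_space\<close>)
qed

lemma nn_integral_hyp: "(\<integral>\<^sup>+x. ennreal (hyp S x) \<partial>M) = 1"
  using nn_integral_eq_integral[OF integrable_hyp] by (simp add: integral_hyp hyp_def)

lemma prob_space_hyp: "prob_space (density M (\<lambda>x. ennreal (hyp S x)))"
  using nn_integral_hyp by (intro prob_spaceI) (simp add: emeasure_density)

text \<open>All terms but the one at \<open>z\<close> cancel in the difference of the densities. As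
  \<open>\<phi> z\<close> has norm 1, the squared distance is \<open>4 * c\<^sup>2\<close>, of which
  \<open>hellinger_affinity_ge\<close> subtracts a quarter.\<close>

lemma affinity_hyp_flip:
  assumes "z \<in> Z"
  shows "ennreal (1 - c\<^sup>2) \<le> (\<integral>\<^sup>+x. ennreal (sqrt (hyp S x) * sqrt (hyp (flip z S) x)) \<partial>M)"
proof -
  have AE: "AE x in M. (hyp S x - hyp (flip z S) x)\<^sup>2 = 4 * c\<^sup>2 * (\<phi> z x * \<phi> z x)"
    using AE_hyp[of S] AE_hyp[of "flip z S"]
  proof eventually_elim
    case (elim x)
    have "signed_sum S x - signed_sum (flip z S) x = (\<Sum>y\<in>Z. if y = z then 2 * sign_at S z * \<phi> z x else 0)"
      unfolding signed_sum_def sum_subtractf[symmetric] by (intro sum.cong) (auto simp: sign_at_flip)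
    also have "\<dots> = 2 * sign_at S z * \<phi> z x" using assms finite_Z by simp
    finally have "hyp S x - hyp (flip z S) x = c * (2 * sign_at S z * \<phi> z x)"
      using elim by (simp add: right_diff_distrib[symmetric])
    then have "(hyp S x - hyp (flip z S) x)\<^sup>2 = 4 * c\<^sup>2 * (sign_at S z * sign_at S z) * (\<phi> z x * \<phi> z x)"
      by (simp add: power2_eq_square mult_ac)
    then show ?case by simp
  qed
  note [measurable] = meas[OF assms]
  have int: "integrable M (\<lambda>x. 4 * c\<^sup>2 * (\<phi> z x * \<phi> z x))"
    using integrable_mult_bounded meas bounded assms by auto
  have "integrable M (\<lambda>x. (hyp S x - hyp (flip z S) x)\<^sup>2)"
    by (subst integrable_cong_AE[OF _ _ AE]) (use int in auto)
  moreover have "(\<integral>x. (hyp S x - hyp (flip z S) x)\<^sup>2 \<partial>M) = 4 * c\<^sup>2"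
    using assms by (subst integral_cong_AE[OF _ _ AE]) (auto simp: ortho)
  ultimately show ?thesis
    using hellinger_affinity_ge[OF measurable_hyp measurable_hyp integrable_hyp integrable_hyp, of S "flip z S"]
      integral_hyp AE_hyp by auto
qed

lemma min_pow_density_hyp_ge:
  assumes "z \<in> Z" "real n * c\<^sup>2 \<le> 1/8" "c \<le> 1"
  shows "ennreal (1/2) \<le> (\<integral>\<^sup>+x. min (pow_density n (hyp S) x) (pow_density n (hyp (flip z S)) x) \<partial>PiM {..<n} (\<lambda>_. M))"
proof (rule nn_integral_min_pow_density_ge[OF prob_space_axioms measurable_hyp measurable_hyp _ _ nn_integral_hyp
      nn_integral_hyp affinity_hyp_flip[OF \<open>z \<in> Z\<close>]])
  have "c\<^sup>2 \<le> 1" using assms c_nonneg by (simp add: power_le_one)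
  then show "0 \<le> 1 - c\<^sup>2" by simp
  \<comment> \<open>Bernoulli's inequality gives at least \<open>1 - real n * c\<^sup>2\<close>,
    hence 7/8.\<close>
  have "1 + real n * (- c\<^sup>2) \<le> (1 + - c\<^sup>2) ^ n"
    using \<open>c\<^sup>2 \<le> 1\<close> by (intro Bernoulli_inequality) simp
  then show "7/8 \<le> (1 - c\<^sup>2) ^ n" using assms by simp
qed (auto simp: hyp_def)

end

section \<open>The minimax lower bound for generalized ellipses\<close>

theorem theorem3:
  fixes J :: "'z set"
    and \<phi> :: "'z \<Rightarrow> real ^ 'd \<Rightarrow> real"
    and a b :: "'z \<Rightarrow> real"
    and L\<^sub>D L\<^sub>G p q A\<^sub>Z B\<^sub>Z :: real
    and n :: nat
    and Z :: "'z set"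
  assumes "countable J"
    and "\<And>z. z \<in> J \<Longrightarrow> bounded (\<phi> z ` unit_cube)"
    and "orthonormal_basis_L2 cube_lebesgue (insert None (Some ` J)) (case_option (\<lambda>x. 1) \<phi>)"
    and "\<And>z. z \<in> J \<Longrightarrow> a z \<ge> 0" and "\<And>z. z \<in> J \<Longrightarrow> b z \<ge> 0"
    and "L\<^sub>D \<ge> 0" and "L\<^sub>G \<ge> 0"
    and "p \<ge> 2" and "q \<ge> 2"
    and "n \<ge> 1"
    and "finite Z" and "Z \<noteq> {}" and "Z \<subseteq> J"
    and "(SUP z\<in>Z. a z) > 0" and "(SUP z\<in>Z. b z) > 0"
    and "A\<^sub>Z = sqrt (real (card Z)) * (SUP z\<in>Z. a z)"
    and "B\<^sub>Z = sqrt (real (card Z)) * (SUP z\<in>Z. b z)"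
    and "B\<^sub>Z \<ge> 16 * L\<^sub>G * sqrt (real n / ln 2)"
    and "ereal (2 * (L\<^sub>G / B\<^sub>Z)) * (\<Sum>z\<in>Z. Linf_norm cube_lebesgue (\<phi> z)) \<le> 1"
  shows "minimax_rate TYPE('w) n unit_cube
           (ellipse_discriminators J \<phi> p a L\<^sub>D) (ellipse_distributions J \<phi> q b L\<^sub>G)
         \<ge> ennreal (L\<^sub>G * L\<^sub>D * real (card Z) / (64 * A\<^sub>Z * B\<^sub>Z))
       \<and> L\<^sub>G * L\<^sub>D * real (card Z) / (64 * A\<^sub>Z * B\<^sub>Z)
         = L\<^sub>G * L\<^sub>D / (64 * (SUP z\<in>Z. a z) * (SUP z\<in>Z. b z))"
proof -
  let ?M = "cube_lebesgue :: (real ^ 'd) measure"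
  define \<alpha> \<beta> where "\<alpha> = (SUP z\<in>Z. a z)" and "\<beta> = (SUP z\<in>Z. b z)"
  define c\<^sub>G c\<^sub>D where "c\<^sub>G = L\<^sub>G / B\<^sub>Z" and "c\<^sub>D = L\<^sub>D / A\<^sub>Z"
  note ZJ = subsetD[OF \<open>Z \<subseteq> J\<close>]
  have N: "real (card Z) > 0" using \<open>finite Z\<close> \<open>Z \<noteq> {}\<close> by (simp add: card_gt_0_iff)
  have \<alpha>\<beta>: "\<alpha> > 0" "\<beta> > 0" and AB: "A\<^sub>Z = sqrt (real (card Z)) * \<alpha>" "B\<^sub>Z = sqrt (real (card Z)) * \<beta>"
    using assms by (simp_all add: \<alpha>_def \<beta>_def)
  then have pos: "A\<^sub>Z > 0" "B\<^sub>Z > 0" using N by simp_all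
  then have c: "c\<^sub>G \<ge> 0" "c\<^sub>D \<ge> 0" using assms by (simp_all add: c\<^sub>G_def c\<^sub>D_def)
  have le_\<alpha>: "a z \<le> \<alpha>" and le_\<beta>: "b z \<le> \<beta>" if "z \<in> Z" for z
    using that \<open>finite Z\<close> by (auto simp: \<alpha>_def \<beta>_def intro!: cSUP_upper)

  have "unit_cube \<in> sets (borel :: (real ^ 'd) measure)"
    unfolding unit_cube_def by measurable
  then have space: "space ?M = unit_cube" and sets: "sets ?M = sets (restrict_space borel unit_cube)"
    unfolding cube_lebesgue_def by (simp_all add: space_restrict_space sets_restrict_space)

  let ?e = "case_option (\<lambda>x. 1) \<phi>"
  have on: "(\<integral>x. ?e i x * ?e j x \<partial>?M) = (if i = j then 1 else 0)" and L2: "?e i \<in> L2_fun ?M"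
    if "i \<in> insert None (Some ` J)" "j \<in> insert None (Some ` J)" for i j
    using assms(3) that unfolding orthonormal_basis_L2_def by blast+
  \<comment> \<open>The constant basis function, with index \<open>None\<close>, has norm 1, so the
    cube has measure 1. As \<open>measure\<close> sends infinity to 0, this also excludes infinite
    mass.\<close>
  have "measure ?M (space ?M) = 1" using on[of None None] by simp
  then interpret prob_space ?M
    by (intro prob_spaceI) (metis emeasure_eq_ennreal_measure ennreal_1 measure_def
        enn2real_top zero_neq_one)
  have meas_J: "\<phi> z \<in> borel_measurable ?M" and mean_J: "(\<integral>x. \<phi> z x \<partial>?M) = 0" if "z \<in> J" for z
    using on[of None "Some z"] L2[of "Some z" None] that by (simp_all add: L2_fun_def)
  have ortho_J: "(\<integral>x. \<phi> z x * \<phi> w x \<partial>?M) = (if z = w then 1 else 0)" if "z \<in> J" "w \<in> J" for z w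
    using on[of "Some z" "Some w"] that by simp
  have small: "AE x in ?M. 2 * c\<^sub>G * (\<Sum>z\<in>Z. \<bar>\<phi> z x\<bar>) \<le> 1"
    using c assms(19) \<open>finite Z\<close> unfolding c\<^sub>G_def by (intro AE_weighted_sum_le_of_Linf) auto
  interpret bounded_orthonormal_system ?M Z \<phi> c\<^sub>G
    by unfold_locales (use assms ZJ meas_J mean_J ortho_J c small space in auto)

  let ?FD = "ellipse_discriminators J \<phi> p a L\<^sub>D" and ?FG = "ellipse_distributions J \<phi> q b L\<^sub>G"
  let ?Q = "\<lambda>S. density ?M (\<lambda>x. ennreal (hyp S x))"
  have signed_phi: "(\<integral>x. signed_sum S x * \<phi> z x \<partial>?M) = (if z \<in> Z then sign_at S z else 0)" if "z \<in> J" for S z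
  proof -
    have "(\<integral>x. signed_sum S x * \<phi> z x \<partial>?M) = (\<Sum>y\<in>Z. sign_at S y * (\<integral>x. \<phi> y x * \<phi> z x \<partial>?M))"
      using that assms(2) meas_J space by (intro integral_signed_sum_mult) auto
    also have "\<dots> = (\<Sum>y\<in>Z. sign_at S y * (if y = z then 1 else 0))"
      using that ortho_J ZJ by (intro sum.cong) auto
    also have "\<dots> = (if z \<in> Z then sign_at S z else 0)"
      using \<open>finite Z\<close> by (simp add: if_distrib cong: if_cong)
    finally show ?thesis .
  qed
  \<comment> \<open>The coefficients are \<open>c\<^sub>D\<close> up to sign on \<open>Z\<close> and
    0 elsewhere; the choice of \<open>c\<^sub>D\<close> makes the size condition of
    \<open>in_ellipse_finite_support\<close> an equality. The same holds for
    \<open>c\<^sub>G\<close> and the hypotheses.\<close>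
  have in_FD: "(\<lambda>x. c\<^sub>D * signed_sum S x) \<in> ?FD" for S
  proof -
    have "bounded ((\<lambda>x. c\<^sub>D * signed_sum S x) ` unit_cube)"
      using bounded_scaleR_comp[OF bounded_signed_sum, of c\<^sub>D S] by (simp add: space)
    moreover have "in_ellipse J p a L\<^sub>D (\<lambda>z. \<integral>x. c\<^sub>D * signed_sum S x * \<phi> z x \<partial>?M)"
    proof (rule in_ellipse_finite_support[of Z J p c\<^sub>D a \<alpha>])
      have coeff: "(\<integral>x. c\<^sub>D * signed_sum S x * \<phi> z x \<partial>?M) = c\<^sub>D * (if z \<in> Z then sign_at S z else 0)"
        if "z \<in> J" for z
        using signed_phi[OF that, of S] by (simp add: mult.assoc)
      show "\<bar>\<integral>x. c\<^sub>D * signed_sum S x * \<phi> z x \<partial>?M\<bar> = c\<^sub>D" if "z \<in> Z" for z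
        using that c coeff[OF ZJ[OF that]] by (simp add: abs_mult)
      show "(\<integral>x. c\<^sub>D * signed_sum S x * \<phi> z x \<partial>?M) = 0" if "z \<in> J - Z" for z
        using that coeff by simp
      show "sqrt (real (card Z)) * \<alpha> * c\<^sub>D \<le> L\<^sub>D"
        using pos by (simp add: c\<^sub>D_def flip: AB)
    qed (use assms c le_\<alpha> ZJ in auto)
    ultimately show ?thesis
      using integrable_signed_sum by (simp add: ellipse_discriminators_def)
  qed
  have coeff: "(\<integral>x. \<phi> z x \<partial>?Q S) = (if z \<in> Z then c\<^sub>G * sign_at S z else 0)" if "z \<in> J" for S z
    using that assms(2) meas_J mean_J by (simp add: integral_hyp_mult signed_phi space)
  have in_FG: "?Q S \<in> ?FG" for S
  proof -
    have "in_ellipse J q b L\<^sub>G (\<lambda>z. \<integral>x. \<phi> z x \<partial>?Q S)"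
    proof (rule in_ellipse_finite_support[of Z J q c\<^sub>G b \<beta>])
      show "sqrt (real (card Z)) * \<beta> * c\<^sub>G \<le> L\<^sub>G"
        using pos by (simp add: c\<^sub>G_def flip: AB)
    qed (use assms c le_\<beta> ZJ coeff in \<open>auto simp: abs_mult\<close>)
    then show ?thesis
      using prob_space_hyp sets by (simp add: ellipse_distributions_def)
  qed

  \<comment> \<open>Squaring the assumption on \<open>B\<^sub>Z\<close> bounds the left side by
    \<open>ln 2 / 256\<close>.\<close>
  have c\<^sub>G_small: "real n * c\<^sub>G\<^sup>2 \<le> 1/8"
  proof -
    have "c\<^sub>G * sqrt (real n / ln 2) \<le> 1/16"
      using assms(18) pos by (simp add: c\<^sub>G_def field_simps)
    then have "(c\<^sub>G * sqrt (real n / ln 2))\<^sup>2 \<le> (1/16)\<^sup>2"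
      using c by (intro power_mono) auto
    then have "real n * c\<^sub>G\<^sup>2 \<le> ln 2 / 256"
      by (simp add: power_mult_distrib field_simps power2_eq_square)
    also have "ln (2::real) \<le> 1" using ln_le_minus_one[of "2::real"] by simp
    finally show ?thesis by simp
  qed
  have "c\<^sub>G\<^sup>2 \<le> real n * c\<^sub>G\<^sup>2" using \<open>n \<ge> 1\<close> by (simp add: mult_le_cancel_right1)
  then have "c\<^sub>G\<^sup>2 \<le> 1" using c\<^sub>G_small by simp
  then have "c\<^sub>G \<le> 1" using c by (simp add: power_le_one_iff abs_square_le_1)

  define \<kappa> where "\<kappa> = c\<^sub>D * c\<^sub>G"
  have loss: "ennreal (\<kappa> * (\<Sum>z\<in>Z. \<bar>sign_at S z - (\<integral>x. \<phi> z x \<partial>Q) / c\<^sub>G\<bar>)) \<le> adversarial_loss ?FD (?Q S) Q"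
    if "Q \<in> ?FG" for S Q
  proof -
    \<comment> \<open>Dividing by \<open>c\<^sub>G\<close> normalizes the coefficients, so that
      those of \<open>?Q S\<close> on \<open>Z\<close> become signs.\<close>
    define t where "t z = (\<integral>x. \<phi> z x \<partial>Q) / c\<^sub>G" for z
    define d where "d z = (\<integral>x. \<phi> z x \<partial>?Q S) - (\<integral>x. \<phi> z x \<partial>Q)" for z
    \<comment> \<open>The discriminator carrying the signs of the coefficient differences turns the
      difference of expectations into their l1 norm over \<open>Z\<close>.\<close>
    let ?S = "{z. d z \<ge> 0}"
    have integral_signed: "(\<integral>x. c\<^sub>D * signed_sum S' x \<partial>P) = c\<^sub>D * (\<Sum>z\<in>Z. sign_at S' z * (\<integral>x. \<phi> z x \<partial>P))"
      if "P \<in> ?FG" for P S'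
    proof -
      have P: "prob_space P" "sets P = sets ?M"
        using that sets by (auto simp: ellipse_distributions_def)
      \<comment> \<open>\<open>P\<close> may be singular to Lebesgue measure, so integrability rests
        on boundedness everywhere on the cube.\<close>
      then have "integrable P (\<phi> z)" if "z \<in> Z" for z
        using that ZJ meas_J assms(2) space sets_eq_imp_space_eq[OF P(2)]
        by (intro integrable_bounded_prob) (auto cong: measurable_cong_sets)
      then show ?thesis
        by (simp add: signed_sum_def Bochner_Integration.integral_sum)
    qed
    have "\<kappa> * (\<Sum>z\<in>Z. \<bar>sign_at S z - t z\<bar>) \<le> c\<^sub>D * (\<Sum>z\<in>Z. \<bar>d z\<bar>)"
    proof (cases "c\<^sub>G = 0") \<comment> \<open>then \<open>t\<close> is a junk value, but \<open>\<kappa> = 0\<close>\<close>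
      case False
      have "\<kappa> * \<bar>sign_at S z - t z\<bar> = c\<^sub>D * \<bar>d z\<bar>" if "z \<in> Z" for z
      proof -
        have "d z = c\<^sub>G * (sign_at S z - t z)"
          using that ZJ False by (simp add: d_def t_def coeff right_diff_distrib)
        then show ?thesis using c by (simp add: \<kappa>_def abs_mult)
      qed
      then show ?thesis by (simp add: sum_distrib_left)
    qed (use c in \<open>simp add: \<kappa>_def sum_nonneg\<close>)
    also have "\<dots> = c\<^sub>D * (\<Sum>z\<in>Z. sign_at ?S z * d z)"
      by (intro arg_cong[where f = "\<lambda>x. c\<^sub>D * x"] sum.cong) (auto simp: sign_at_def)
    also have "\<dots> = (\<integral>x. c\<^sub>D * signed_sum ?S x \<partial>?Q S) - (\<integral>x. c\<^sub>D * signed_sum ?S x \<partial>Q)"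
      unfolding integral_signed[OF in_FG] integral_signed[OF that]
      by (simp add: d_def right_diff_distrib sum_subtractf)
    also have "\<dots> \<le> \<bar>\<dots>\<bar>" by simp
    finally show ?thesis
      unfolding adversarial_loss_def t_def
      by (intro SUP_upper2[OF in_FD[of ?S]] ennreal_leI) auto
  qed

  have "ennreal (L\<^sub>G * L\<^sub>D * real (card Z) / (64 * A\<^sub>Z * B\<^sub>Z)) \<le> minimax_rate TYPE('w) n unit_cube ?FD ?FG"
    unfolding minimax_rate_def
  proof (rule INF_greatest, clarify)
    fix R :: "'w measure" and T
    assume "(R, T) \<in> estimators n (unit_cube :: (real ^ 'd) set) ?FG"
    then have R: "prob_space R"
      and T: "\<And>x \<omega>. x \<in> {..<n} \<rightarrow>\<^sub>E unit_cube \<Longrightarrow> \<omega> \<in> space R \<Longrightarrow> T x \<omega> \<in> ?FG"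
      by (auto simp: estimators_def)
    let ?l = "\<lambda>P. \<lambda>(x, \<omega>). adversarial_loss ?FD P (T x \<omega>)"
    have "L\<^sub>G * L\<^sub>D * real (card Z) / (64 * A\<^sub>Z * B\<^sub>Z) = \<kappa> * real (card Z) / 64"
      by (simp add: \<kappa>_def c\<^sub>G_def c\<^sub>D_def mult_ac)
    \<comment> \<open>Assouad's bound with \<open>\<eta> = 1/2\<close> yields the constant 1/2,
      which is weakened to 1/64.\<close>
    also have "\<dots> \<le> \<kappa> * real (card Z) * (1/2)" using c by (simp add: \<kappa>_def)
    finally have "ennreal (L\<^sub>G * L\<^sub>D * real (card Z) / (64 * A\<^sub>Z * B\<^sub>Z)) \<le> ennreal (\<kappa> * real (card Z) * (1/2))"
      by (rule ennreal_leI)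
    also have "\<dots> = ennreal (\<kappa> * real (card Z)) * ennreal (1/2)"
      using c by (intro ennreal_mult) (auto simp: \<kappa>_def)
    also have "\<dots> = ennreal \<kappa> * of_nat (card Z) * ennreal (1/2)"
      using c by (simp add: \<kappa>_def ennreal_mult ennreal_of_nat_eq_real_of_nat)
    also have "\<dots> \<le> (SUP S\<in>Pow Z. outer_expectation (PiM {..<n} (\<lambda>_. ?Q S) \<Otimes>\<^sub>M R) (?l (?Q S)))"
    \<comment> \<open>The estimate is the vector of normalized coefficients of the estimator's
      output, a function of sample and seed with no measurability required.\<close>
    proof (rule assouad[where t = "\<lambda>z (x, \<omega>). (\<integral>u. \<phi> z u \<partial>T x \<omega>) / c\<^sub>G"])
      fix S y assume "y \<in> space (PiM {..<n} (\<lambda>_. ?M) \<Otimes>\<^sub>M R)"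
      then obtain x \<omega> where "y = (x, \<omega>)" "x \<in> {..<n} \<rightarrow>\<^sub>E unit_cube" "\<omega> \<in> space R"
        by (auto simp: space_pair_measure space_PiM space)
      then show "ennreal (\<kappa> * (\<Sum>z\<in>Z. \<bar>sign_at S z - (case y of (x, \<omega>) \<Rightarrow> (\<integral>u. \<phi> z u \<partial>T x \<omega>) / c\<^sub>G)\<bar>)) \<le> ?l (?Q S) y"
        using loss[OF T] by simp
    qed (use c R prob_space_axioms \<open>finite Z\<close> nn_integral_hyp min_pow_density_hyp_ge c\<^sub>G_small \<open>c\<^sub>G \<le> 1\<close> in
        \<open>auto simp: \<kappa>_def\<close>)
    also have "\<dots> \<le> (SUP P\<in>?FG. outer_expectation (PiM {..<n} (\<lambda>_. P) \<Otimes>\<^sub>M R) (?l P))"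
      using in_FG by (intro SUP_least SUP_upper)
    finally show "ennreal (L\<^sub>G * L\<^sub>D * real (card Z) / (64 * A\<^sub>Z * B\<^sub>Z))
        \<le> (SUP P\<in>?FG. outer_expectation (PiM {..<n} (\<lambda>_. P) \<Otimes>\<^sub>M R) (?l P))" .
  qed
  moreover have "L\<^sub>G * L\<^sub>D * real (card Z) / (64 * A\<^sub>Z * B\<^sub>Z) = L\<^sub>G * L\<^sub>D / (64 * \<alpha> * \<beta>)"
  proof -
    have "A\<^sub>Z * B\<^sub>Z = real (card Z) * (\<alpha> * \<beta>)" unfolding AB using N by (simp add: mult_ac)
    then show ?thesis using N \<alpha>\<beta> by (simp add: mult.assoc)
  qed
  ultimately show ?thesis by (simp add: \<alpha>_def \<beta>_def)
qed

end
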